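(* Let $P$ be a finite poset. (i) $\operatorname{gap}(P)=0$ if and only if $\operatorname{St}(P)=\varnothing$. (ii) $\operatorname{gap}(P)=1$ if and only if there is exactly one star element $q$ of $P$ and $(d(q),r(q))=(2,2)$. (iii) $\operatorname{gap}(P)=2$ if and only if exactly one of the following occurs: (a) there are exactly two star elements $q_1,q_2$ of $P$, and $(d(q_i),r(q_i))=(2,2)$ for $i=1,2$; (b) there is exactly one star element $q$ of $P$, and $(d(q),r(q))\in\{(2,3),(3,2)\}$.
   Context: All posets are finite. Let $P$ be a poset with $n=|P|$ elements. The order polytope $\mathcal O(P)\subset\mathbb R^P$ is the set of $x\in[0,1]^P$ with $x_p\le x_q$ whenever $p\le q$ in $P$. The chain polytope $\mathcal C(P)\subset\mathbb R^P$ is the set of $x\in\mathbb R^P$ with $x_p\ge 0$ for all $p\in P$ and $x_{p_1}+\dots+x_{p_k}\le 1$ for every chain $p_1<\dots<p_k$ in $P$. Both are $n$-dimensional; $f_{n-1}$ denotes the number of facets, and $$\operatorname{gap}(P)=f_{n-1}(\mathcal C(P))-f_{n-1}(\mathcal O(P)).$$ Let $\widehat P=P\sqcup\{\widehat 0,\widehat 1\}$ be obtained from $P$ by adjoining a new smallest element $\widehat 0$ and a new largest element $\widehat 1$. Write $q\lessdot x$ if $x$ covers $q$ in $\widehat P$. For $q\in P$ let $d(q)$ be the number of maximal (i.e. saturated) chains in $\widehat P$ from $\widehat 0$ to $q$, and let $r(q)=\#\{x\in\widehat P: q\lessdot x\}$. An element $q\in P$ is a star element if $d(q)\ge 2$ and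 $r(q)\ge 2$; $\operatorname{St}(P)$ is the set of star elements of $P$. *)

theory Defs
  imports "HOL-Analysis.Analysis" "HOL-Library.Extended"
begin

text \<open>
  A finite poset is a subset \<open>P\<close> of a finite partially ordered type, with the induced order;
  \<open>P = UNIV\<close> gives the poset on the whole type, and \<open>P = {}\<close> the empty poset.
  The space of real vectors indexed by \<open>P\<close> is realised as the coordinate subspace of
  \<open>real ^ 'a\<close> consisting of the vectors that vanish outside \<open>P\<close>.
\<close>

definition coord_space :: "'a::finite set \<Rightarrow> (real ^ ('a::finite)) set" where
  "coord_space P = {x. \<forall>p. p \<notin> P \<longrightarrow> x $ p = 0}"

definition order_polytope :: "'a::{finite,order} set \<Rightarrow> (real ^ ('a::{finite,order})) set" where
  "order_polytope P = {x \<in> coord_space P.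
     (\<forall>p\<in>P. 0 \<le> x $ p \<and> x $ p \<le> 1) \<and>
     (\<forall>p\<in>P. \<forall>q\<in>P. p \<le> q \<longrightarrow> x $ p \<le> x $ q)}"

definition chain_polytope :: "'a::{finite,order} set \<Rightarrow> (real ^ ('a::{finite,order})) set" where
  "chain_polytope P = {x \<in> coord_space P.
     (\<forall>p\<in>P. 0 \<le> x $ p) \<and>
     (\<forall>C. C \<subseteq> P \<and> Complete_Partial_Order.chain (\<le>) C \<longrightarrow> (\<Sum>p\<in>C. x $ p) \<le> 1)}"

text \<open>
  The library's \<open>facet_of\<close> excludes the empty face, so for \<open>P = {}\<close> (both polytopes are a
  point) both facet numbers are 0; counting the empty face as a facet of a point would make
  both equal to 1, with the same difference.
\<close>

definition num_facets :: "'n::euclidean_space set \<Rightarrow> nat" where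
  "num_facets S = card {F. F facet_of S}"

definition gap :: "'a::{finite,order} set \<Rightarrow> int" where
  "gap P = int (num_facets (chain_polytope P)) - int (num_facets (order_polytope P))"

text \<open>In \<open>'a extended\<close>, \<open>Minf\<close> and \<open>Pinf\<close> are the adjoined least and greatest elements.\<close>

definition hat :: "'a::order set \<Rightarrow> 'a extended set" where
  "hat P = insert Minf (insert Pinf (Fin ` P))"

definition covers :: "'b::order set \<Rightarrow> 'b \<Rightarrow> 'b \<Rightarrow> bool" where
  "covers Q x y \<longleftrightarrow> x \<in> Q \<and> y \<in> Q \<and> x < y \<and> \<not> (\<exists>z\<in>Q. x < z \<and> z < y)"

text \<open>A saturated chain is represented by the increasing list of its elements.\<close>

definition saturated_chains :: "'b::order set \<Rightarrow> 'b \<Rightarrow> 'b \<Rightarrow> 'b list set" where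
  "saturated_chains Q x y =
     {cs. cs \<noteq> [] \<and> set cs \<subseteq> Q \<and> hd cs = x \<and> last cs = y \<and> successively (covers Q) cs}"

definition chain_count :: "'a::order set \<Rightarrow> 'a \<Rightarrow> nat" where
  "chain_count P q = card (saturated_chains (hat P) Minf (Fin q))"

definition cover_count :: "'a::order set \<Rightarrow> 'a \<Rightarrow> nat" where
  "cover_count P q = card {x \<in> hat P. covers (hat P) (Fin q) x}"

definition star_elements :: "'a::order set \<Rightarrow> 'a set" where
  "star_elements P = {q \<in> P. chain_count P q \<ge> 2 \<and> cover_count P q \<ge> 2}"

end

theory Submission
  imports Defs
begin

text \<open>
  For nonempty \<open>P\<close> the facets of the order polytope correspond to the cover relations of \<open>hat P\<close>, and
  those of the chain polytope to the elements of \<open>P\<close> together with the saturated chains from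
  \<open>Minf\<close> to \<open>Pinf\<close>: for each inequality there is a point that violates it alone. Writing
  \<open>d\<close> and \<open>r\<close> for the two counts at an element, the recursion \<open>d v = (\<Sum>u covered by v. d u)\<close>
  summed over all \<open>v\<close> turns the difference into \<open>gap P = (\<Sum>q\<in>P. (d q - 1) * (r q - 1))\<close>. The
  nonzero summands are exactly those of the star elements, and they are positive integers.
\<close>

section \<open>Counting facets from an irredundant system of inequalities\<close>

text \<open>The strict point \<open>y\<close> gives the region full dimension in \<open>L\<close>,
  and the violating points make the system irredundant, so each inequality cuts out its own facet.
  Working inside an affine \<open>L\<close> covers posets carried by a proper subset of the
  type.\<close>

lemma num_facets_eq_card:
  fixes a :: "'i \<Rightarrow> 'n::euclidean_space" and b :: "'i \<Rightarrow> real"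
  assumes fin: "finite I" and L: "affine L"
    and S: "S = L \<inter> {x. \<forall>i\<in>I. a i \<bullet> x \<le> b i}"
    and y: "y \<in> L" "\<And>i. i \<in> I \<Longrightarrow> a i \<bullet> y < b i"
    and viol: "\<And>i. i \<in> I \<Longrightarrow> \<exists>z\<in>L. b i < a i \<bullet> z \<and> (\<forall>j\<in>I - {i}. a j \<bullet> z \<le> b j)"
  shows "num_facets S = card I"
proof -
  obtain z where z: "\<And>i. i \<in> I \<Longrightarrow> z i \<in> L" "\<And>i. i \<in> I \<Longrightarrow> b i < a i \<bullet> z i"
    "\<And>i j. i \<in> I \<Longrightarrow> j \<in> I \<Longrightarrow> j \<noteq> i \<Longrightarrow> a j \<bullet> z i \<le> b j"
    using viol by (metis Diff_iff singletonD)
  \<comment> \<open>\<open>facet_of_polyhedron_explicit\<close> takes a set of halfspaces rather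
    than an indexed family. Since \<open>z i\<close> lies outside \<open>h i\<close> but inside
    every other \<open>h j\<close>, the map \<open>h\<close> is injective and \<open>g\<close>
    recovers the index.\<close>
  define h where "h i = {x. a i \<bullet> x \<le> b i}" for i
  have inj_h: "inj_on h I"
  proof (rule inj_onI)
    fix i j assume ij: "i \<in> I" "j \<in> I" "h i = h j"
    have "z i \<notin> h i"
      using z(2)[OF ij(1)] by (simp add: h_def)
    then have "z i \<notin> h j"
      using ij(3) by simp
    then show "i = j"
      using z(3)[OF ij(1,2)] unfolding h_def by blast
  qed
  define g where "g = the_inv_into I h"
  have g: "g (h i) = i" if "i \<in> I" for i
    unfolding g_def by (rule the_inv_into_f_f[OF inj_h that])
  \<comment> \<open>The strict solutions in \<open>L\<close> form a nonempty relatively open subset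
    of \<open>L\<close>, so they already span \<open>L\<close> affinely.\<close>
  define T where "T = (\<Inter>i\<in>I. {x. a i \<bullet> x < b i})"
  have "open T"
    unfolding T_def using fin by (intro open_INT) (auto intro: open_halfspace_lt)
  moreover have "L \<inter> T \<noteq> {}"
    using y by (auto simp: T_def)
  ultimately have "affine hull (L \<inter> T) = L"
    using L by (simp add: affine_hull_affine_Int_open affine_hull_eq)
  moreover have "L \<inter> T \<subseteq> S" "S \<subseteq> L"
    unfolding S T_def by (auto intro: less_imp_le)
  ultimately have hull: "affine hull S = L"
    by (metis L hull_minimal hull_mono subset_antisym)
  have facet: "C facet_of S \<longleftrightarrow> (\<exists>k. k \<in> h ` I \<and> C = S \<inter> {x. a (g k) \<bullet> x = b (g k)})" for C
  proof (rule facet_of_polyhedron_explicit)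
    show "finite (h ` I)"
      using fin by simp
    show "S = affine hull S \<inter> \<Inter> (h ` I)"
      unfolding hull by (auto simp: S h_def)
    show "a (g k) \<noteq> 0 \<and> k = {x. a (g k) \<bullet> x \<le> b (g k)}" if k: "k \<in> h ` I" for k
    proof -
      obtain i where i: "i \<in> I" "k = h i"
        using k by blast
      \<comment> \<open>The functional takes values on both sides of \<open>b i\<close>, at
        \<open>y\<close> and at \<open>z i\<close>, so it is not constant.\<close>
      have "a i \<noteq> 0"
        using y(2)[OF i(1)] z(2)[OF i(1)] by auto
      then show ?thesis
        using i g by (simp add: h_def)
    qed
    show "S \<subset> affine hull S \<inter> \<Inter> F'" if F': "F' \<subset> h ` I" for F'
    proof -
      obtain i where i: "i \<in> I" "h i \<notin> F'"
        using F' by blast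
      \<comment> \<open>Once the \<open>i\<close>-th halfspace is dropped, \<open>z i\<close>
        satisfies all that remain but is not in \<open>S\<close>.\<close>
      have "z i \<in> \<Inter> F'"
      proof
        fix k assume "k \<in> F'"
        then obtain j where "j \<in> I" "k = h j" "j \<noteq> i"
          using F' i by blast
        then show "z i \<in> k"
          using z(3) i by (simp add: h_def)
      qed
      moreover have "z i \<notin> S"
        using i(1) z(2)[OF i(1)] not_le by (auto simp: S)
      moreover have "S \<subseteq> h i" if "i \<in> I" for i
        using that by (auto simp: S h_def)
      then have "S \<subseteq> \<Inter> F'"
        using F' by blast
      ultimately show ?thesis
        unfolding hull using z(1)[OF i(1)] \<open>S \<subseteq> L\<close> by blast
    qed
  qed
  define \<phi> where "\<phi> i = S \<inter> {x. a i \<bullet> x = b i}" for i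
  have "{C. C facet_of S} = \<phi> ` I"
    unfolding facet \<phi>_def using g by auto
  moreover have "inj_on \<phi> I"
  proof (rule inj_onI, rule ccontr)
    fix i j assume ij: "i \<in> I" "j \<in> I" "\<phi> i = \<phi> j" "i \<noteq> j"
    \<comment> \<open>The segment from \<open>y\<close> to \<open>z i\<close> meets the \<open>i\<close>-th hyperplane in a point
      that satisfies all other inequalities strictly.\<close>
    define t where "t = (b i - a i \<bullet> y) / (a i \<bullet> z i - a i \<bullet> y)"
    define w where "w = (1 - t) *\<^sub>R y + t *\<^sub>R z i"
    have lt: "a i \<bullet> y < b i" "b i < a i \<bullet> z i"
      using y(2) z(2) ij by auto
    then have t: "0 < t" "t < 1"
      by (auto simp: t_def)
    have inner_w: "a k \<bullet> w = (1 - t) * (a k \<bullet> y) + t * (a k \<bullet> z i)" for k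
      by (simp add: w_def inner_add_right)
    have "a i \<bullet> w = b i"
    proof -
      have "a i \<bullet> w = a i \<bullet> y + t * (a i \<bullet> z i - a i \<bullet> y)"
        by (simp add: inner_w algebra_simps)
      also have "\<dots> = b i"
        using lt by (simp add: t_def)
      finally show ?thesis .
    qed
    moreover have strict: "a k \<bullet> w < b k" if "k \<in> I" "k \<noteq> i" for k
    proof -
      have "(1 - t) * (a k \<bullet> y) + t * (a k \<bullet> z i) < (1 - t) * b k + t * b k"
        using y(2)[OF that(1)] z(3)[OF ij(1) that] t
        by (intro add_less_le_mono mult_strict_left_mono mult_left_mono) auto
      then show ?thesis
        by (simp add: inner_w algebra_simps)
    qed
    moreover have "w \<in> L"
      unfolding w_def using L y(1) z(1)[OF ij(1)] t by (intro mem_affine) auto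
    moreover have "a k \<bullet> w \<le> b k" if "k \<in> I" for k
      using strict[OF that] \<open>a i \<bullet> w = b i\<close> by (cases "k = i") auto
    ultimately have "w \<in> \<phi> i"
      unfolding \<phi>_def S by simp
    then have "w \<in> \<phi> j"
      using ij by simp
    then show False
      using strict[of j] ij by (auto simp: \<phi>_def)
  qed
  ultimately show ?thesis
    unfolding num_facets_def by (simp add: card_image)
qed

lemma affine_coord_space: "affine (coord_space P)"
  unfolding coord_space_def
  by (rule subspace_imp_affine) (auto simp: subspace_def)

section \<open>Saturated chains\<close>

lemma sorted_list_of_chain:
  fixes C :: "'b::order set"
  assumes "finite C" "Complete_Partial_Order.chain (\<le>) C"
  shows "\<exists>xs. sorted_wrt (<) xs \<and> set xs = C"
  using assms
proof (induction "card C" arbitrary: C)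
  case 0
  then show ?case by (intro exI[of _ "[]"]) auto
next
  case (Suc n)
  then have "C \<noteq> {}" by auto
  then obtain m where m: "m \<in> C" "\<And>c. c \<in> C \<Longrightarrow> m \<le> c \<Longrightarrow> m = c"
    using finite_has_maximal[OF Suc.prems(1)] by metis
  have lt: "c < m" if "c \<in> C - {m}" for c
    using that m Suc.prems(2) unfolding Complete_Partial_Order.chain_def
    by (metis Diff_iff insert_iff order_le_less)
  have "Complete_Partial_Order.chain (\<le>) (C - {m})"
    using Suc.prems(2) by (auto simp: Complete_Partial_Order.chain_def)
  then obtain xs where "sorted_wrt (<) xs" "set xs = C - {m}"
    using Suc.hyps(1)[of "C - {m}"] Suc.hyps(2) Suc.prems(1) m(1)
    by (metis card_Diff_singleton diff_Suc_1 finite_Diff)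
  then have "sorted_wrt (<) (xs @ [m]) \<and> set (xs @ [m]) = C"
    using lt m(1) by (auto simp: sorted_wrt_append)
  then show ?case by blast
qed

lemma sorted_wrt_less_distinct:
  fixes xs :: "'b::order list"
  shows "sorted_wrt (<) xs \<Longrightarrow> distinct xs"
  by (induction xs) auto

lemma saturated_chain_sorted:
  assumes "cs \<in> saturated_chains Q x y"
  shows "sorted_wrt (<) cs"
proof -
  have "successively (<) cs"
    using assms unfolding saturated_chains_def
    by (auto intro: successively_mono simp: covers_def)
  then show ?thesis
    by (simp add: successively_conv_sorted_wrt)
qed

lemma finite_saturated_chains:
  assumes "finite Q"
  shows "finite (saturated_chains Q x y)"
proof (rule finite_subset)
  show "saturated_chains Q x y \<subseteq> {cs. set cs \<subseteq> Q \<and> distinct cs}"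
  proof
    fix cs assume cs: "cs \<in> saturated_chains Q x y"
    then show "cs \<in> {cs. set cs \<subseteq> Q \<and> distinct cs}"
      using sorted_wrt_less_distinct[OF saturated_chain_sorted[OF cs]]
      by (simp add: saturated_chains_def)
  qed
qed (rule finite_subset_distinct[OF assms])

text \<open>A longest increasing list between \<open>x\<close> and \<open>y\<close> that contains
  \<open>C\<close> is saturated: an element strictly between two neighbours could be inserted.
  Lengths are bounded by the size of \<open>Q\<close>, so a longest list exists. With empty
  \<open>C\<close> the lemma gives bare existence.\<close>

lemma ex_saturated_chain:
  fixes Q :: "'b::order set"
  assumes fin: "finite Q" and xy: "x \<in> Q" "y \<in> Q" "x \<le> y"
    and C: "C \<subseteq> Q" "Complete_Partial_Order.chain (\<le>) C" "\<And>c. c \<in> C \<Longrightarrow> x \<le> c \<and> c \<le> y"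
  shows "\<exists>cs\<in>saturated_chains Q x y. C \<subseteq> set cs"
proof -
  define D where "D = insert x (insert y C)"
  have "finite D"
    using fin C finite_subset by (auto simp: D_def)
  moreover have "Complete_Partial_Order.chain (\<le>) D"
    using C xy by (auto simp: D_def Complete_Partial_Order.chain_def)
  ultimately obtain xs where xs: "sorted_wrt (<) xs" "set xs = D"
    using sorted_list_of_chain by blast
  define K where "K ys \<longleftrightarrow> sorted_wrt (<) ys \<and> D \<subseteq> set ys \<and> set ys \<subseteq> {c \<in> Q. x \<le> c \<and> c \<le> y}" for ys
  have K_xs: "K xs"
    using xs C xy by (auto simp: K_def D_def)
  have bound: "length ys < Suc (card Q)" if "K ys" for ys
  proof -
    have "length ys = card (set ys)"
      using that sorted_wrt_less_distinct[of ys] by (simp add: K_def distinct_card)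
    also have "\<dots> \<le> card Q"
      using that fin by (intro card_mono) (auto simp: K_def)
    finally show ?thesis by simp
  qed
  obtain cs where cs: "K cs" "\<And>ys. K ys \<Longrightarrow> length ys \<le> length cs"
    using ex_has_greatest_nat[of K xs length "Suc (card Q)"] K_xs bound by (metis less_imp_le)
  have ne: "cs \<noteq> []" and sorted: "sorted_wrt (<) cs"
    using cs(1) by (auto simp: K_def D_def)
  have "hd cs = x"
  proof (cases cs)
    case (Cons u us)
    then show ?thesis
      using cs(1) by (auto simp: K_def D_def)
  qed (use ne in auto)
  moreover have "last cs = y"
  proof (cases cs rule: rev_cases)
    case (snoc us u)
    then show ?thesis
      using cs(1) by (auto simp: K_def D_def sorted_wrt_append)
  qed (use ne in auto)
  moreover have "successively (covers Q) cs"
    unfolding successively_conv_nth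
  proof (intro allI impI)
    fix i assume i: "Suc i < length cs"
    define u v where "u = cs ! i" and "v = cs ! Suc i"
    have split: "cs = take i cs @ u # v # drop (Suc (Suc i)) cs"
      using i by (simp add: u_def v_def Cons_nth_drop_Suc Suc_lessD)
    obtain as bs where ab: "cs = as @ u # v # bs"
      using split by blast
    have "\<not> (u < w \<and> w < v)" if "w \<in> Q" for w
    proof
      assume w: "u < w \<and> w < v"
      have "sorted_wrt (<) (as @ u # w # v # bs)"
        using sorted w unfolding ab by (auto simp: sorted_wrt_append intro: order.strict_trans)
      moreover have "x \<le> w" "w \<le> y"
        using w cs(1) unfolding ab K_def by (auto intro: order.trans)
      ultimately have "K (as @ u # w # v # bs)"
        using cs(1) that unfolding ab K_def by auto
      then show False
        using cs(2) unfolding ab by fastforce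
    qed
    moreover have "u < v" "u \<in> Q" "v \<in> Q"
      using sorted cs(1) unfolding ab K_def by (auto simp: sorted_wrt_append)
    ultimately show "covers Q (cs ! i) (cs ! Suc i)"
      unfolding covers_def u_def v_def by blast
  qed
  ultimately have "cs \<in> saturated_chains Q x y"
    using ne cs(1) by (auto simp: saturated_chains_def K_def)
  then show ?thesis
    using cs(1) by (auto simp: K_def D_def)
qed

text \<open>Compare from the bottom: the second element \<open>v\<close> of the smaller chain occurs
  in the larger one, whose second element \<open>w\<close> thus satisfies \<open>x < w\<close> and
  \<open>w \<le> v\<close>. As \<open>v\<close> covers \<open>x\<close>, the two agree, and
  induction continues. This antichain property makes the chain inequalities irredundant.\<close>

lemma saturated_chain_subset_eq:
  assumes "cs \<in> saturated_chains Q x y" "ds \<in> saturated_chains Q x y" "set cs \<subseteq> set ds"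
  shows "cs = ds"
  using assms
proof (induction cs arbitrary: ds x)
  case Nil
  then show ?case by (simp add: saturated_chains_def)
next
  case (Cons c cs)
  have c: "c = x"
    using Cons.prems(1) by (simp add: saturated_chains_def)
  obtain es where ds: "ds = x # es"
    using Cons.prems(2) by (cases ds) (auto simp: saturated_chains_def)
  have lt: "\<forall>e\<in>set es. x < e" "\<forall>e\<in>set cs. x < e"
    using saturated_chain_sorted[OF Cons.prems(1)] saturated_chain_sorted[OF Cons.prems(2)] c ds
    by auto
  show ?case
  proof (cases cs)
    case Nil
    \<comment> \<open>A nonempty \<open>es\<close> would end in \<open>y = x\<close>, although all
      its elements exceed \<open>x\<close>.\<close>
    then have "y = x"
      using Cons.prems(1) by (auto simp add: saturated_chains_def)
    then have "es = []"
      using Cons.prems(2) lt(1) last_in_set[of es] by (auto simp: saturated_chains_def ds split: if_splits)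
    then show ?thesis using Nil c ds by simp
  next
    case cs: (Cons v vs)
    have "v \<in> set es"
      using Cons.prems(3) lt(2) unfolding cs ds by auto
    then obtain w ws where es: "es = w # ws"
      by (cases es) auto
    have "covers Q x v" "covers Q x w"
      using Cons.prems(1,2) unfolding cs ds es c by (auto simp: saturated_chains_def)
    moreover have "v = w \<or> w < v"
      using \<open>v \<in> set es\<close> saturated_chain_sorted[OF Cons.prems(2)] unfolding ds es by auto
    ultimately have "v = w"
      by (auto simp: covers_def)
    have "cs \<in> saturated_chains Q v y" "es \<in> saturated_chains Q v y"
      using Cons.prems(1,2) unfolding cs ds es c \<open>v = w\<close> by (auto simp: saturated_chains_def)
    moreover have "set cs \<subseteq> set es"
      using Cons.prems(3) lt(2) unfolding ds by auto
    ultimately have "cs = es"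
      by (rule Cons.IH)
    then show ?thesis using c ds by simp
  qed
qed

lemma covers_mono_imp_mono:
  fixes f :: "'b::order \<Rightarrow> 'c::order"
  assumes fin: "finite Q" and mono: "\<And>u v. covers Q u v \<Longrightarrow> f u \<le> f v"
    and xy: "x \<in> Q" "y \<in> Q" "x \<le> y"
  shows "f x \<le> f y"
proof -
  obtain cs where cs: "cs \<in> saturated_chains Q x y"
    using ex_saturated_chain[OF fin xy, of "{}"] by (auto simp: Complete_Partial_Order.chain_def)
  then show ?thesis
  proof (induction cs arbitrary: x)
    case Nil
    then show ?case by (simp add: saturated_chains_def)
  next
    case (Cons c cs)
    show ?case
    proof (cases cs)
      case Nil
      then show ?thesis using Cons.prems by (auto simp add: saturated_chains_def)
    next
      case cs: (Cons v vs)
      have "covers Q x v" "cs \<in> saturated_chains Q v y"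
        using Cons.prems unfolding cs by (auto simp: saturated_chains_def)
      then show ?thesis
        using Cons.IH mono order.trans by blast
    qed
  qed
qed

text \<open>Deleting the final \<open>y\<close> leaves a saturated chain to some \<open>q\<close>
  covered by \<open>y\<close>. Its last element determines \<open>q\<close>, so the union over
  \<open>q\<close> is disjoint.\<close>

lemma card_saturated_chains_rec:
  fixes Q :: "'b::order set"
  assumes fin: "finite Q" and y: "y \<in> Q" "x \<noteq> y"
  shows "card (saturated_chains Q x y) = (\<Sum>q | covers Q q y. card (saturated_chains Q x q))"
proof -
  have "saturated_chains Q x y = (\<Union>q\<in>{q. covers Q q y}. (\<lambda>cs. cs @ [y]) ` saturated_chains Q x q)"
    (is "_ = ?R")
  proof (intro equalityI subsetI)
    fix cs assume cs: "cs \<in> saturated_chains Q x y"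
    then obtain ds where ds: "cs = ds @ [y]"
      by (cases cs rule: rev_cases) (auto simp: saturated_chains_def)
    have "ds \<noteq> []"
      using cs y(2) by (auto simp: saturated_chains_def ds)
    then have "covers Q (last ds) y" "ds \<in> saturated_chains Q x (last ds)"
      using cs by (auto simp: saturated_chains_def ds successively_append_iff)
    then show "cs \<in> ?R"
      unfolding ds by blast
  next
    fix cs assume "cs \<in> ?R"
    then show "cs \<in> saturated_chains Q x y"
      using y(1) by (auto simp: saturated_chains_def successively_append_iff)
  qed
  moreover have "finite {q. covers Q q y}"
    using fin by (rule rev_finite_subset) (auto simp: covers_def)
  moreover have "(\<lambda>cs. cs @ [y]) ` saturated_chains Q x q \<inter> (\<lambda>cs. cs @ [y]) ` saturated_chains Q x q' = {}"
    if "q \<noteq> q'" for q q'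
    using that by (auto simp: saturated_chains_def)
  ultimately show ?thesis
    using finite_saturated_chains[OF fin]
    by (simp add: card_UN_disjoint card_image inj_on_def)
qed

lemma saturated_chains_refl:
  fixes Q :: "'b::order set"
  assumes "x \<in> Q"
  shows "saturated_chains Q x x = {[x]}"
proof -
  have x: "[x] \<in> saturated_chains Q x x"
    using assms by (simp add: saturated_chains_def)
  \<comment> \<open>Every such chain contains the saturated chain \<open>[x]\<close>, so the
    antichain property applies.\<close>
  have "cs = [x]" if cs: "cs \<in> saturated_chains Q x x" for cs
  proof -
    have "x \<in> set cs"
      using cs hd_in_set[of cs] by (simp add: saturated_chains_def)
    then have "set [x] \<subseteq> set cs"
      by simp
    then show ?thesis
      using saturated_chain_subset_eq[OF x cs] by simp
  qed
  with x show ?thesis by blast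
qed

section \<open>The poset with least and greatest element adjoined\<close>

lemma finite_hat: "finite P \<Longrightarrow> finite (hat P)"
  by (simp add: hat_def)

lemma hat_simps [simp]: "Minf \<in> hat P" "Pinf \<in> hat P" "Fin p \<in> hat P \<longleftrightarrow> p \<in> P"
  by (auto simp: hat_def)

lemma sum_hat:
  assumes "finite P"
  shows "(\<Sum>u\<in>hat P. f u) = f Minf + f Pinf + (\<Sum>p\<in>P. f (Fin p))"
proof -
  have "(\<Sum>u\<in>Fin ` P. f u) = (\<Sum>p\<in>P. f (Fin p))"
    by (subst sum.reindex) (auto simp: inj_on_def)
  then show ?thesis
    unfolding hat_def using assms by (subst sum.insert; auto simp: add.assoc)+
qed

lemma chain_count_ge_1:
  fixes P :: "'a::order set"
  assumes "finite P" "q \<in> P"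
  shows "1 \<le> chain_count P q"
proof -
  have "saturated_chains (hat P) Minf (Fin q) \<noteq> {}"
    using ex_saturated_chain[of "hat P" Minf "Fin q" "{}"] assms
    by (auto simp: finite_hat Complete_Partial_Order.chain_def)
  then show ?thesis
    using finite_saturated_chains[OF finite_hat[OF assms(1)]]
    by (simp add: chain_count_def card_gt_0_iff Suc_le_eq)
qed

lemma cover_count_ge_1:
  fixes P :: "'a::order set"
  assumes "finite P" "q \<in> P"
  shows "1 \<le> cover_count P q"
proof -
  let ?A = "{x \<in> hat P. Fin q < x}"
  have "finite ?A" "Pinf \<in> ?A"
    using finite_hat[OF assms(1)] by auto
  then obtain m where m: "m \<in> ?A" "\<And>x. x \<in> ?A \<Longrightarrow> x \<le> m \<Longrightarrow> m = x"
    using finite_has_minimal[of ?A] by blast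
  have "covers (hat P) (Fin q) m"
    unfolding covers_def
  proof (intro conjI notI)
    assume "\<exists>z\<in>hat P. Fin q < z \<and> z < m"
    then obtain z where z: "z \<in> hat P" "Fin q < z" "z < m" by blast
    then have "m = z"
      by (intro m(2)) auto
    with z(3) show False by simp
  qed (use m(1) assms in auto)
  then have "{x \<in> hat P. covers (hat P) (Fin q) x} \<noteq> {}"
    using m(1) by blast
  then show ?thesis
    using finite_hat[OF assms(1)] by (simp add: cover_count_def card_gt_0_iff Suc_le_eq)
qed

section \<open>Double counting over the cover relations\<close>

lemma card_covers:
  fixes Q :: "'b::order set"
  assumes "finite Q"
  shows "card {(u, v). covers Q u v} = (\<Sum>u\<in>Q. card {v \<in> Q. covers Q u v})"
proof -
  have "{(u, v). covers Q u v} = Sigma Q (\<lambda>u. {v \<in> Q. covers Q u v})"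
    by (auto simp: covers_def)
  then show ?thesis
    using assms by simp
qed

text \<open>Both sides sum the chain count of \<open>u\<close> over all cover pairs
  \<open>(u, v)\<close>. Grouping by \<open>v\<close> and applying the recursion gives the right
  side; the least element \<open>x\<close> covers nothing and drops out.\<close>

lemma sum_chain_count_times_cover_count:
  fixes Q :: "'b::order set"
  assumes fin: "finite Q" and x: "x \<in> Q" "\<And>u. u \<in> Q \<Longrightarrow> x \<le> u"
  shows "(\<Sum>u\<in>Q. card (saturated_chains Q x u) * card {v \<in> Q. covers Q u v})
    = (\<Sum>v\<in>Q - {x}. card (saturated_chains Q x v))"
proof -
  have "(\<Sum>u\<in>Q. card (saturated_chains Q x u) * card {v \<in> Q. covers Q u v})
      = (\<Sum>u\<in>Q. \<Sum>v | v \<in> Q \<and> covers Q u v. card (saturated_chains Q x u))"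
    by (simp add: mult.commute)
  also have "\<dots> = (\<Sum>v\<in>Q. \<Sum>u | u \<in> Q \<and> covers Q u v. card (saturated_chains Q x u))"
    by (rule sum.swap_restrict[OF fin fin])
  also have "\<dots> = (\<Sum>v\<in>Q - {x}. \<Sum>u | u \<in> Q \<and> covers Q u v. card (saturated_chains Q x u))"
  proof (rule sum.mono_neutral_right[OF fin])
    show "\<forall>v\<in>Q - (Q - {x}). (\<Sum>u | u \<in> Q \<and> covers Q u v. card (saturated_chains Q x u)) = 0"
    proof
      fix v assume "v \<in> Q - (Q - {x})"
      then have "{u. u \<in> Q \<and> covers Q u v} = {}"
        using x(2) by (auto simp: covers_def dest: leD)
      then show "(\<Sum>u | u \<in> Q \<and> covers Q u v. card (saturated_chains Q x u)) = 0"
        by (metis sum.empty)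
    qed
  qed auto
  also have "\<dots> = (\<Sum>v\<in>Q - {x}. card (saturated_chains Q x v))"
  proof (rule sum.cong[OF refl])
    fix v assume v: "v \<in> Q - {x}"
    have "{u. u \<in> Q \<and> covers Q u v} = {u. covers Q u v}"
      by (auto simp: covers_def)
    then show "(\<Sum>u | u \<in> Q \<and> covers Q u v. card (saturated_chains Q x u)) = card (saturated_chains Q x v)"
      using v by (auto simp: card_saturated_chains_rec[OF fin])
  qed
  finally show ?thesis .
qed

text \<open>Expanding the product leaves sums over \<open>P\<close>, whereas the double count runs
  over \<open>hat P\<close>. The endpoints are known: \<open>Minf\<close> has one chain, so it
  contributes its cover count alone, and \<open>Pinf\<close> has no upper covers.\<close>

lemma sum_chain_count_cover_count:
  fixes P :: "'a::order set"
  assumes "finite P"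
  shows "int (card P) + int (card (saturated_chains (hat P) Minf Pinf))
      - int (card {(u, v). covers (hat P) u v})
    = (\<Sum>q\<in>P. (int (chain_count P q) - 1) * (int (cover_count P q) - 1))"
proof -
  define d where "d u = int (card (saturated_chains (hat P) Minf u))" for u
  define r where "r u = int (card {v \<in> hat P. covers (hat P) u v})" for u
  have d_Minf: "d Minf = 1"
    by (simp add: d_def saturated_chains_refl)
  have "{v \<in> hat P. covers (hat P) Pinf v} = {}"
    by (auto simp: covers_def)
  then have r_Pinf: "r Pinf = 0"
    unfolding r_def by (metis card.empty of_nat_0)
  have "(\<Sum>u\<in>hat P. d u * r u) = (\<Sum>v\<in>hat P - {Minf}. d v)"
    using sum_chain_count_times_cover_count[of "hat P" Minf] finite_hat[OF assms]
    unfolding d_def r_def of_nat_mult[symmetric] of_nat_sum[symmetric] by simp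
  also have "\<dots> = (\<Sum>v\<in>hat P. d v) - d Minf"
    using finite_hat[OF assms] by (simp add: sum_diff1)
  finally have "r Minf + (\<Sum>q\<in>P. d (Fin q) * r (Fin q)) = d Pinf + (\<Sum>q\<in>P. d (Fin q))"
    by (simp add: sum_hat[OF assms] d_Minf r_Pinf)
  moreover have "int (card {(u, v). covers (hat P) u v}) = r Minf + (\<Sum>q\<in>P. r (Fin q))"
    unfolding card_covers[OF finite_hat[OF assms]] of_nat_sum r_def[symmetric]
    by (simp add: sum_hat[OF assms] r_Pinf)
  moreover have "(\<Sum>q\<in>P. (d (Fin q) - 1) * (r (Fin q) - 1))
      = (\<Sum>q\<in>P. d (Fin q) * r (Fin q)) - (\<Sum>q\<in>P. d (Fin q)) - (\<Sum>q\<in>P. r (Fin q)) + int (card P)"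
    by (simp add: algebra_simps sum.distrib sum_subtractf)
  ultimately show ?thesis
    unfolding chain_count_def cover_count_def d_def[symmetric] r_def[symmetric] by linarith
qed

section \<open>Facets of the order polytope\<close>

fun hat_coord :: "real ^ 'a \<Rightarrow> 'a extended \<Rightarrow> real" where
  "hat_coord x (Fin p) = x $ p"
| "hat_coord x Pinf = 1"
| "hat_coord x Minf = 0"

text \<open>For fixed \<open>u\<close>, \<open>hat_coord x u\<close> is affine in \<open>x\<close>,
  with gradient \<open>hat_normal u\<close> and constant term \<open>hat_const u\<close>. This puts
  comparisons of labels, including the fixed labels 0 and 1, into the halfspace form of
  \<open>num_facets_eq_card\<close>.\<close>

fun hat_normal :: "'a extended \<Rightarrow> real ^ ('a::finite)" where
  "hat_normal (Fin p) = axis p 1"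
| "hat_normal Pinf = 0"
| "hat_normal Minf = 0"

fun hat_const :: "'a extended \<Rightarrow> real" where
  "hat_const (Fin p) = 0"
| "hat_const Pinf = 1"
| "hat_const Minf = 0"

lemma hat_coord_eq: "hat_coord x u = hat_normal u \<bullet> x + hat_const u"
  by (cases u) (auto simp: inner_axis' )

lemma hat_halfspace_iff:
  "(hat_normal u - hat_normal v) \<bullet> x \<le> hat_const v - hat_const u \<longleftrightarrow> hat_coord x u \<le> hat_coord x v"
  "(hat_normal u - hat_normal v) \<bullet> x < hat_const v - hat_const u \<longleftrightarrow> hat_coord x u < hat_coord x v"
  "hat_const v - hat_const u < (hat_normal u - hat_normal v) \<bullet> x \<longleftrightarrow> hat_coord x v < hat_coord x u"
  unfolding hat_coord_eq by (auto simp: inner_diff_left)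

text \<open>The bounds 0 and 1 are comparisons with \<open>Minf\<close> and \<open>Pinf\<close>, so
  every defining inequality is monotonicity on \<open>hat P\<close>, which follows along saturated
  chains from the covers.\<close>

lemma order_polytope_eq_covers:
  fixes P :: "'a::{finite,order} set"
  shows "order_polytope P
    = coord_space P \<inter> {x. \<forall>(u, v)\<in>{(u, v). covers (hat P) u v}. hat_coord x u \<le> hat_coord x v}"
proof (intro equalityI subsetI)
  fix x assume x: "x \<in> order_polytope P"
  have "hat_coord x u \<le> hat_coord x v" if "covers (hat P) u v" for u v
    using that x unfolding covers_def order_polytope_def
    by (cases u; cases v) (auto simp: less_imp_le)
  with x show "x \<in> coord_space P \<inter> {x. \<forall>(u, v)\<in>{(u, v). covers (hat P) u v}. hat_coord x u \<le> hat_coord x v}"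
    by (auto simp: order_polytope_def)
next
  fix x assume "x \<in> coord_space P \<inter> {x. \<forall>(u, v)\<in>{(u, v). covers (hat P) u v}. hat_coord x u \<le> hat_coord x v}"
  then have x: "x \<in> coord_space P" "\<And>u v. covers (hat P) u v \<Longrightarrow> hat_coord x u \<le> hat_coord x v"
    by auto
  have mono: "hat_coord x u \<le> hat_coord x v" if "u \<in> hat P" "v \<in> hat P" "u \<le> v" for u v
    using covers_mono_imp_mono[of "hat P" "hat_coord x"] x(2) that finite_hat[of P] by auto
  have "0 \<le> x $ p \<and> x $ p \<le> 1" if "p \<in> P" for p
    using mono[of Minf "Fin p"] mono[of "Fin p" Pinf] that by simp
  moreover have "x $ p \<le> x $ q" if "p \<in> P" "q \<in> P" "p \<le> q" for p q
    using mono[of "Fin p" "Fin q"] that by simp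
  ultimately show "x \<in> order_polytope P"
    using x(1) by (simp add: order_polytope_def)
qed

text \<open>An affine rescaling of a labelling of \<open>hat P\<close> turns the labels of \<open>Minf\<close> and \<open>Pinf\<close> into
  0 and 1 without affecting the comparison of labels.\<close>

lemma ex_coord_space_hat_coord:
  fixes f :: "'a::{finite,order} extended \<Rightarrow> real"
  assumes "f Minf < f Pinf"
  shows "\<exists>x\<in>coord_space P. \<forall>u\<in>hat P. \<forall>v\<in>hat P. hat_coord x u \<le> hat_coord x v \<longleftrightarrow> f u \<le> f v"
proof -
  define x where "x = (\<chi> p. if p \<in> P then (f (Fin p) - f Minf) / (f Pinf - f Minf) else 0)"
  have "hat_coord x u = (f u - f Minf) / (f Pinf - f Minf)" if "u \<in> hat P" for u
    using that assms by (cases u) (auto simp: x_def)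
  moreover have "x \<in> coord_space P"
    by (simp add: x_def coord_space_def)
  ultimately show ?thesis
    using assms by (intro bexI[of _ x]) (auto simp: divide_le_cancel)
qed

lemma num_facets_order_polytope:
  fixes P :: "'a::{finite,order} set"
  assumes "P \<noteq> {}"
  shows "num_facets (order_polytope P) = card {(u, v). covers (hat P) u v}"
proof -
  let ?Q = "hat P"
  let ?E = "{(u, v). covers ?Q u v}"
  have fin: "finite ?Q"
    by (simp add: finite_hat)
  \<comment> \<open>A strictly increasing labelling: rescaled, it gives the strict point
    \<open>y\<close>, and below it also serves as a perturbation.\<close>
  define g where "g u = real (card {w \<in> ?Q. w < u})" for u
  have g_strict: "g u < g v" if "u \<in> ?Q" "u < v" for u v
    unfolding g_def of_nat_less_iff using that fin by (intro psubset_card_mono) auto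
  have g_bound: "0 \<le> g u" "g u \<le> card ?Q" for u
    unfolding g_def using fin by (auto intro: card_mono)
  obtain y where y: "y \<in> coord_space P"
    "\<And>u v. u \<in> ?Q \<Longrightarrow> v \<in> ?Q \<Longrightarrow> hat_coord y u \<le> hat_coord y v \<longleftrightarrow> g u \<le> g v"
    using ex_coord_space_hat_coord[of g P] g_strict[of Minf Pinf] by auto
  show ?thesis
  proof (rule num_facets_eq_card)
    show "finite ?E"
      by (rule finite_subset[of _ "?Q \<times> ?Q"]) (use fin in \<open>auto simp: covers_def\<close>)
    show "affine (coord_space P)"
      by (rule affine_coord_space)
    show "order_polytope P = coord_space P \<inter> {x. \<forall>e\<in>?E.
        (case e of (u, v) \<Rightarrow> hat_normal u - hat_normal v) \<bullet> x \<le> (case e of (u, v) \<Rightarrow> hat_const v - hat_const u)}"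
      unfolding order_polytope_eq_covers by (auto simp: hat_halfspace_iff)
    show "y \<in> coord_space P"
      by (rule y)
    show "(case e of (u, v) \<Rightarrow> hat_normal u - hat_normal v) \<bullet> y < (case e of (u, v) \<Rightarrow> hat_const v - hat_const u)"
      if "e \<in> ?E" for e
    proof -
      obtain u v where e: "e = (u, v)" "covers ?Q u v"
        using \<open>e \<in> ?E\<close> by blast
      then have "\<not> hat_coord y v \<le> hat_coord y u"
        using y(2)[of v u] g_strict[of u v] by (auto simp: covers_def)
      then show ?thesis
        by (simp add: e hat_halfspace_iff)
    qed
    show "\<exists>z\<in>coord_space P. (case e of (u, v) \<Rightarrow> hat_const v - hat_const u) < (case e of (u, v) \<Rightarrow> hat_normal u - hat_normal v) \<bullet> z \<and>
        (\<forall>e'\<in>?E - {e}. (case e' of (u, v) \<Rightarrow> hat_normal u - hat_normal v) \<bullet> z \<le> (case e' of (u, v) \<Rightarrow> hat_const v - hat_const u))"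
      if "e \<in> ?E" for e
    proof -
      obtain u v where e: "e = (u, v)" and uv: "covers ?Q u v"
        using \<open>e \<in> ?E\<close> by blast
      \<comment> \<open>The indicator of \<open>{w. u \<le> w} - {v}\<close> decreases along the edge \<open>(u, v)\<close> only; the small
        multiple of \<open>g\<close> separates the labels of \<open>Minf\<close> and \<open>Pinf\<close>.\<close>
      define f where "f w = of_bool (u \<le> w \<and> w \<noteq> v) + g w / (real (card ?Q) + 1)" for w
      have small: "0 \<le> g w / (real (card ?Q) + 1)" "g w / (real (card ?Q) + 1) < 1" for w
        using g_bound[of w] by (auto simp: divide_simps)
      have g_less: "g w / (real (card ?Q) + 1) < g w' / (real (card ?Q) + 1)" if "w \<in> ?Q" "w < w'" for w w'
        using g_strict[OF that] by (simp add: divide_strict_right_mono)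
      \<comment> \<open>For this pair the inequality would be 0 <= 1, which no point violates; a
        nonempty \<open>P\<close> keeps \<open>Pinf\<close> from covering
        \<open>Minf\<close>.\<close>
      have "\<not> (u = Minf \<and> v = Pinf)"
      proof
        assume "u = Minf \<and> v = Pinf"
        moreover obtain p where "p \<in> P"
          using assms by blast
        ultimately show False
          using uv by (auto simp: covers_def dest: bspec[of _ _ "Fin p"])
      qed
      then have "of_bool (u \<le> Minf \<and> Minf \<noteq> v) \<le> (of_bool (u \<le> Pinf \<and> Pinf \<noteq> v) :: real)"
        by auto
      then have "f Minf < f Pinf"
        unfolding f_def using g_less[of Minf Pinf] by (intro add_le_less_mono) auto
      then obtain z where z: "z \<in> coord_space P"
        "\<And>u v. u \<in> ?Q \<Longrightarrow> v \<in> ?Q \<Longrightarrow> hat_coord z u \<le> hat_coord z v \<longleftrightarrow> f u \<le> f v"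
        using ex_coord_space_hat_coord[of f P] by blast
      have "f u = 1 + g u / (real (card ?Q) + 1)" "f v = g v / (real (card ?Q) + 1)"
        using uv by (auto simp: f_def covers_def)
      then have "f v < f u"
        using small(1)[of u] small(2)[of v] by linarith
      then have "hat_coord z v < hat_coord z u"
        using z(2)[of u v] uv by (auto simp: covers_def)
      moreover have "hat_coord z u' \<le> hat_coord z v'" if "covers ?Q u' v'" "(u', v') \<noteq> (u, v)" for u' v'
      proof -
        \<comment> \<open>The indicator set is left upwards only by stepping onto \<open>v\<close>.
          Doing so from some \<open>u'\<close> other than \<open>u\<close> would put
          \<open>u'\<close> strictly between \<open>u\<close> and \<open>v\<close>.\<close>
        have "u \<le> v' \<and> v' \<noteq> v" if "u \<le> u' \<and> u' \<noteq> v"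
        proof
          show "u \<le> v'"
            using that \<open>covers ?Q u' v'\<close> by (auto simp: covers_def)
          show "v' \<noteq> v"
          proof
            assume "v' = v"
            then have "u < u'" "u' < v"
              using that \<open>covers ?Q u' v'\<close> \<open>(u', v') \<noteq> (u, v)\<close> by (auto simp: covers_def)
            then show False
              using uv \<open>covers ?Q u' v'\<close> by (auto simp: covers_def)
          qed
        qed
        then have "f u' \<le> f v'"
          unfolding f_def using g_less[of u' v'] that(1)
          by (intro add_mono) (auto simp: covers_def of_bool_def less_imp_le)
        then show ?thesis
          using z(2)[of u' v'] that(1) by (auto simp: covers_def)
      qed
      ultimately have "\<forall>e'\<in>?E - {e}. case e' of (u', v') \<Rightarrow> hat_coord z u' \<le> hat_coord z v'"
        "hat_coord z v < hat_coord z u"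
        unfolding e by blast+
      then show ?thesis
        using z(1) unfolding e by (intro bexI[of _ z]) (simp_all add: hat_halfspace_iff case_prod_beta)
    qed
  qed
qed

section \<open>Facets of the chain polytope\<close>

lemma saturated_hat_chain_props:
  fixes P :: "'a::{finite,order} set"
  assumes "cs \<in> saturated_chains (hat P) Minf Pinf"
  shows "Fin -` set cs \<subseteq> P" "Complete_Partial_Order.chain (\<le>) (Fin -` set cs)"
    "Minf \<in> set cs" "Pinf \<in> set cs"
proof -
  have cs: "set cs \<subseteq> hat P" "Minf \<in> set cs" "Pinf \<in> set cs"
    using assms hd_in_set[of cs] last_in_set[of cs] by (auto simp: saturated_chains_def)
  show "Fin -` set cs \<subseteq> P"
    using cs(1) by (auto simp: hat_def)
  show "Minf \<in> set cs" "Pinf \<in> set cs"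
    by (rule cs)+
  have "u \<le> v \<or> v \<le> u" if "u \<in> set cs" "v \<in> set cs" for u v
    using saturated_chain_sorted[OF assms] that
    by (induction cs) (auto simp: less_imp_le)
  from this[of "Fin _" "Fin _"] show "Complete_Partial_Order.chain (\<le>) (Fin -` set cs)"
    by (simp add: Complete_Partial_Order.chain_def)
qed

text \<open>All these chains share \<open>Minf\<close> and \<open>Pinf\<close>, so their traces on
  \<open>P\<close> inherit the antichain property.\<close>

lemma saturated_hat_chain_subset_eq:
  fixes P :: "'a::{finite,order} set"
  assumes cs: "cs \<in> saturated_chains (hat P) Minf Pinf" and ds: "ds \<in> saturated_chains (hat P) Minf Pinf"
    and "Fin -` set cs \<subseteq> Fin -` set ds"
  shows "cs = ds"
proof (rule saturated_chain_subset_eq[OF cs ds])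
  show "set cs \<subseteq> set ds"
  proof
    fix u assume u: "u \<in> set cs"
    show "u \<in> set ds"
      by (cases u) (use u assms(3) saturated_hat_chain_props(3,4)[OF ds] in auto)
  qed
qed

lemma ex_saturated_hat_chain:
  fixes P :: "'a::{finite,order} set"
  assumes "C \<subseteq> P" "Complete_Partial_Order.chain (\<le>) C"
  shows "\<exists>cs\<in>saturated_chains (hat P) Minf Pinf. C \<subseteq> Fin -` set cs"
proof -
  have "\<exists>cs\<in>saturated_chains (hat P) Minf Pinf. Fin ` C \<subseteq> set cs"
    using assms
    by (intro ex_saturated_chain) (auto simp: finite_hat Complete_Partial_Order.chain_def)
  then show ?thesis by blast
qed

text \<open>Every chain extends to a saturated one, and by nonnegativity the extra terms only
  increase the sum.\<close>

lemma chain_polytope_eq_saturated: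
  fixes P :: "'a::{finite,order} set"
  shows "chain_polytope P = coord_space P \<inter> {x. (\<forall>p\<in>P. 0 \<le> x $ p) \<and>
    (\<forall>cs\<in>saturated_chains (hat P) Minf Pinf. (\<Sum>p\<in>Fin -` set cs. x $ p) \<le> 1)}"
proof (intro equalityI subsetI)
  fix x assume "x \<in> chain_polytope P"
  then show "x \<in> coord_space P \<inter> {x. (\<forall>p\<in>P. 0 \<le> x $ p) \<and>
    (\<forall>cs\<in>saturated_chains (hat P) Minf Pinf. (\<Sum>p\<in>Fin -` set cs. x $ p) \<le> 1)}"
    using saturated_hat_chain_props(1,2) by (fastforce simp: chain_polytope_def)
next
  fix x assume x: "x \<in> coord_space P \<inter> {x. (\<forall>p\<in>P. 0 \<le> x $ p) \<and>
    (\<forall>cs\<in>saturated_chains (hat P) Minf Pinf. (\<Sum>p\<in>Fin -` set cs. x $ p) \<le> 1)}"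
  have "(\<Sum>p\<in>C. x $ p) \<le> 1" if C: "C \<subseteq> P" "Complete_Partial_Order.chain (\<le>) C" for C
  proof -
    obtain cs where cs: "cs \<in> saturated_chains (hat P) Minf Pinf" "C \<subseteq> Fin -` set cs"
      using ex_saturated_hat_chain[OF C] by blast
    have "(\<Sum>p\<in>C. x $ p) \<le> (\<Sum>p\<in>Fin -` set cs. x $ p)"
      using cs(2) saturated_hat_chain_props(1)[OF cs(1)] x by (intro sum_mono2) auto
    also have "\<dots> \<le> 1"
      using x cs(1) by auto
    finally show ?thesis .
  qed
  then show "x \<in> chain_polytope P"
    using x by (auto simp: chain_polytope_def)
qed

lemma inner_indicator_vec:
  fixes x :: "real ^ 'a"
  shows "(\<chi> p. of_bool (p \<in> A)) \<bullet> x = (\<Sum>p\<in>A. x $ p)"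
  by (simp add: inner_vec_def sum.If_cases of_bool_def if_distrib[of "\<lambda>c. c * _"] cong: if_cong)

lemma num_facets_chain_polytope:
  fixes P :: "'a::{finite,order} set"
  assumes "P \<noteq> {}"
  shows "num_facets (chain_polytope P) = card P + card (saturated_chains (hat P) Minf Pinf)"
proof -
  define S where "S = saturated_chains (hat P) Minf Pinf"
  define supp where "supp cs = (Fin -` set cs :: 'a set)" for cs
  \<comment> \<open>\<open>Inl p\<close> indexes the nonnegativity of coordinate \<open>p\<close>,
    and \<open>Inr cs\<close> the inequality of the chain \<open>cs\<close>.\<close>
  define a :: "'a + 'a extended list \<Rightarrow> real ^ ('a::{finite,order})"
    where "a = case_sum (\<lambda>p. - axis p 1) (\<lambda>cs. \<chi> p. of_bool (p \<in> supp cs))"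
  define b :: "'a + 'a extended list \<Rightarrow> real" where "b = case_sum (\<lambda>_. 0) (\<lambda>_. 1)"
  have a: "a (Inl p) \<bullet> x = - x $ p" "a (Inr cs) \<bullet> x = (\<Sum>p\<in>supp cs. x $ p)" for p cs x
    by (auto simp: a_def inner_axis' inner_indicator_vec)
  have b: "b (Inl p) = 0" "b (Inr cs) = 1" for p cs
    by (auto simp: b_def)
  have finS: "finite S"
    unfolding S_def by (intro finite_saturated_chains finite_hat) simp
  have supp_P: "supp cs \<subseteq> P" if "cs \<in> S" for cs
    using saturated_hat_chain_props(1) that by (simp add: S_def supp_def)
  have eq: "cs = ds" if "cs \<in> S" "ds \<in> S" "supp cs \<subseteq> supp ds" for cs ds
    using saturated_hat_chain_subset_eq that by (auto simp: S_def supp_def)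
  \<comment> \<open>An empty trace lies in every other one, so by the antichain property
    \<open>cs\<close> would be the only chain; but some chain passes through an element of
    \<open>P\<close>.\<close>
  have supp_ne: "supp cs \<noteq> {}" if "cs \<in> S" for cs
  proof
    assume empty: "supp cs = {}"
    obtain p where "p \<in> P"
      using assms by blast
    then obtain ds where "ds \<in> S" "p \<in> supp ds"
      using ex_saturated_hat_chain[of "{p}" P] by (auto simp: S_def supp_def Complete_Partial_Order.chain_def)
    then show False
      using eq[OF that, of ds] empty by auto
  qed
  have "num_facets (chain_polytope P) = card (P <+> S)"
  proof (rule num_facets_eq_card)
    show "finite (P <+> S)"
      using finS by simp
    show "affine (coord_space P)"
      by (rule affine_coord_space)
    show "chain_polytope P = coord_space P \<inter> {x. \<forall>i\<in>P <+> S. a i \<bullet> x \<le> b i}"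
      unfolding chain_polytope_eq_saturated S_def[symmetric] supp_def[symmetric] Plus_def ball_Un
      by (auto simp: a b)
    \<comment> \<open>The weights are small enough that even all of \<open>P\<close> has total
      weight below 1.\<close>
    define y :: "real ^ ('a::{finite,order})" where "y = (\<chi> p. if p \<in> P then 1 / (real (card P) + 1) else 0)"
    show "y \<in> coord_space P"
      by (simp add: y_def coord_space_def)
    show "a i \<bullet> y < b i" if "i \<in> P <+> S" for i
    proof (cases i)
      case (Inl p)
      then show ?thesis using that by (auto simp: a b y_def)
    next
      case (Inr cs)
      then have cs: "cs \<in> S" using that by auto
      have "(\<Sum>p\<in>supp cs. y $ p) = (\<Sum>p\<in>supp cs. 1 / (real (card P) + 1))"
        using supp_P[OF cs] by (intro sum.cong) (auto simp: y_def)
      also have "\<dots> = real (card (supp cs)) / (real (card P) + 1)"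
        by simp
      also have "\<dots> < 1"
        using card_mono[OF _ supp_P[OF cs]] by (simp add: divide_simps)
      finally show ?thesis
        by (simp add: Inr a b)
    qed
    show "\<exists>z\<in>coord_space P. b i < a i \<bullet> z \<and> (\<forall>j\<in>(P <+> S) - {i}. a j \<bullet> z \<le> b j)"
      if "i \<in> P <+> S" for i
    proof (cases i)
      case (Inl p)
      then have "p \<in> P" using that by auto
      \<comment> \<open>One negative coordinate violates its own sign condition and can only lower
        the chain sums.\<close>
      define z :: "real ^ ('a::{finite,order})" where "z = - axis p 1"
      have z: "z $ q = (if q = p then - 1 else 0)" for q
        by (simp add: z_def axis_def)
      have "(\<Sum>q\<in>A. z $ q) \<le> 1" for A
        by (rule order.trans[of _ 0], rule sum_nonpos) (auto simp: z)
      moreover have "z \<in> coord_space P"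
        using \<open>p \<in> P\<close> by (auto simp: z coord_space_def)
      ultimately show ?thesis
        by (intro bexI[of _ z]) (auto simp: Inl a b z split: if_split_asm)
    next
      case (Inr cs)
      then have cs: "cs \<in> S" using that by auto
      define k where "k = card (supp cs)"
      have k: "1 \<le> k"
        using supp_ne[OF cs] by (simp add: k_def Suc_le_eq card_gt_0_iff)
      \<comment> \<open>Any \<open>t\<close> with \<open>t * k > 1\<close> and \<open>t * (k - 1) \<le> 1\<close> serves.\<close>
      define t where "t = 2 / (2 * real k - 1)"
      have t: "0 < t" "1 < t * k" "t * (real k - 1) \<le> 1"
        using k by (auto simp: t_def divide_simps)
      define z :: "real ^ ('a::{finite,order})" where "z = (\<chi> p. if p \<in> supp cs then t else 0)"
      have sum_z: "(\<Sum>p\<in>A. z $ p) = t * card (A \<inter> supp cs)" for A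
        by (simp add: z_def sum.If_cases)
      have others: "(\<Sum>p\<in>supp ds. z $ p) \<le> 1" if "ds \<in> S" "ds \<noteq> cs" for ds
      proof -
        \<comment> \<open>By the antichain property another chain misses some element of
          \<open>supp cs\<close>, so it collects the weight \<open>t\<close> at most
          \<open>k - 1\<close> times.\<close>
        have "supp ds \<inter> supp cs \<subset> supp cs"
          using eq[OF cs that(1)] that(2) by blast
        then have "card (supp ds \<inter> supp cs) < k"
          unfolding k_def by (intro psubset_card_mono) auto
        then have "real (card (supp ds \<inter> supp cs)) \<le> real k - 1"
          by linarith
        then have "t * card (supp ds \<inter> supp cs) \<le> t * (real k - 1)"
          using t(1) by simp
        then show ?thesis
          using t(3) by (simp add: sum_z)
      qed
      have "z \<in> coord_space P"
        using supp_P[OF cs] by (auto simp: z_def coord_space_def)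
      moreover have "0 \<le> z $ p" for p
        using t(1) by (simp add: z_def)
      moreover have "1 < (\<Sum>p\<in>supp cs. z $ p)"
        using t(2) by (simp add: sum_z k_def)
      ultimately show ?thesis
        by (intro bexI[of _ z]) (auto simp: Inr a b intro: others)
    qed
  qed
  then show ?thesis
    using finS by (simp add: card_Plus S_def)
qed

section \<open>The gap\<close>

lemma gap_eq_sum:
  fixes P :: "'a::{finite,order} set"
  shows "gap P = (\<Sum>q\<in>P. (int (chain_count P q) - 1) * (int (cover_count P q) - 1))"
proof (cases "P = {}")
  case True
  \<comment> \<open>The facet counts assume a nonempty poset; for the empty one the two polytopes
    coincide.\<close>
  have "chain_polytope {} = (order_polytope {} :: (real ^ ('a::{finite,order})) set)"
    by (simp add: chain_polytope_def order_polytope_def)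
  then show ?thesis
    by (simp add: True gap_def)
next
  case False
  have "gap P = int (card P) + int (card (saturated_chains (hat P) Minf Pinf))
      - int (card {(u, v). covers (hat P) u v})"
    by (simp add: gap_def num_facets_chain_polytope num_facets_order_polytope False)
  also have "\<dots> = (\<Sum>q\<in>P. (int (chain_count P q) - 1) * (int (cover_count P q) - 1))"
    by (rule sum_chain_count_cover_count) simp
  finally show ?thesis .
qed

lemma gap_eq_sum_star_elements:
  fixes P :: "'a::{finite,order} set"
  shows "gap P = int (\<Sum>q\<in>star_elements P. (chain_count P q - 1) * (cover_count P q - 1))"
proof -
  \<comment> \<open>Both counts are at least 1, so truncated subtraction agrees with integer
    subtraction.\<close>
  have "gap P = (\<Sum>q\<in>P. int ((chain_count P q - 1) * (cover_count P q - 1)))"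
    unfolding gap_eq_sum using chain_count_ge_1[of P] cover_count_ge_1[of P]
    by (intro sum.cong) (auto simp: of_nat_diff)
  also have "\<dots> = (\<Sum>q\<in>star_elements P. int ((chain_count P q - 1) * (cover_count P q - 1)))"
  proof (rule sum.mono_neutral_right)
    show "\<forall>q\<in>P - star_elements P. int ((chain_count P q - 1) * (cover_count P q - 1)) = 0"
    proof
      fix q assume "q \<in> P - star_elements P"
      then have "chain_count P q - 1 = 0 \<or> cover_count P q - 1 = 0"
        by (auto simp: star_elements_def)
      then show "int ((chain_count P q - 1) * (cover_count P q - 1)) = 0"
        by (metis mult_zero_left mult_zero_right of_nat_0)
    qed
  qed (auto simp: star_elements_def)
  finally show ?thesis
    by (simp only: of_nat_sum)
qed

text \<open>Split off any \<open>q\<close>: positivity leaves weight 2 with remainder 0, or weight 1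
  with remainder 1, and \<open>sum_eq_1_iff\<close> settles the latter.\<close>

lemma sum_eq_2_iff:
  fixes w :: "'b \<Rightarrow> nat"
  assumes fin: "finite S" and pos: "\<And>q. q \<in> S \<Longrightarrow> 1 \<le> w q"
  shows "sum w S = 2 \<longleftrightarrow>
    (\<exists>q1 q2. q1 \<noteq> q2 \<and> S = {q1, q2} \<and> w q1 = 1 \<and> w q2 = 1) \<or> (\<exists>q. S = {q} \<and> w q = 2)"
proof
  assume sum: "sum w S = 2"
  then obtain q where q: "q \<in> S"
    by fastforce
  have split: "w q + sum w (S - {q}) = 2"
    using sum sum.remove[OF fin q, of w] by simp
  consider "sum w (S - {q}) = 0" "w q = 2" | "sum w (S - {q}) = 1" "w q = 1"
    using split pos[OF q] by linarith
  then show "(\<exists>q1 q2. q1 \<noteq> q2 \<and> S = {q1, q2} \<and> w q1 = 1 \<and> w q2 = 1) \<or> (\<exists>q. S = {q} \<and> w q = 2)"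
  proof cases
    case 1
    then have "\<forall>p\<in>S - {q}. w p = 0"
      using fin by (simp add: sum_eq_0_iff)
    then have "S - {q} = {}"
      using pos by (metis DiffD1 all_not_in_conv not_one_le_zero)
    then show ?thesis
      using 1 q by blast
  next
    case 2
    then obtain q' where q': "q' \<in> S - {q}" "w q' = 1" "\<forall>p\<in>S - {q}. q' \<noteq> p \<longrightarrow> w p = 0"
      using sum_eq_1_iff[of "S - {q}" w] fin by auto
    then have "p = q \<or> p = q'" if "p \<in> S" for p
      using pos[OF that] that by (metis Diff_iff not_one_le_zero singletonD)
    then have "S = {q, q'}"
      using q q'(1) by blast
    then show ?thesis
      using 2 q' by blast
  qed
next
  assume "(\<exists>q1 q2. q1 \<noteq> q2 \<and> S = {q1, q2} \<and> w q1 = 1 \<and> w q2 = 1) \<or> (\<exists>q. S = {q} \<and> w q = 2)"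
  then show "sum w S = 2"
    by auto
qed

theorem corollary3p1:
  fixes P :: "'a::{finite,order} set"
  shows "(gap P = 0 \<longleftrightarrow> star_elements P = {}) \<and>
    (gap P = 1 \<longleftrightarrow>
       (\<exists>q. star_elements P = {q} \<and> (chain_count P q, cover_count P q) = (2, 2))) \<and>
    (gap P = 2 \<longleftrightarrow>
       ((\<exists>q1 q2. q1 \<noteq> q2 \<and> star_elements P = {q1, q2} \<and>
            (chain_count P q1, cover_count P q1) = (2, 2) \<and>
            (chain_count P q2, cover_count P q2) = (2, 2))
        \<noteq>
        (\<exists>q. star_elements P = {q} \<and>
            (chain_count P q, cover_count P q) \<in> {(2, 3), (3, 2)})))"
proof -
  define S where "S = star_elements P"
  define w where "w q = (chain_count P q - 1) * (cover_count P q - 1)" for q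
  have gap: "gap P = int k \<longleftrightarrow> sum w S = k" for k
    unfolding gap_eq_sum_star_elements S_def w_def by (rule of_nat_eq_iff)
  have fin: "finite S"
    by simp
  have pos: "1 \<le> w q" if "q \<in> S" for q
    using that by (auto simp: S_def w_def star_elements_def Suc_le_eq)
  have w1: "w q = 1 \<longleftrightarrow> (chain_count P q, cover_count P q) = (2, 2)" for q
    by (auto simp: w_def)
  \<comment> \<open>As 2 is prime, weight 2 forces the decremented counts to be 1 and 2 in some
    order.\<close>
  have product_2: "m * n = 2 \<longleftrightarrow> (m = 1 \<and> n = 2) \<or> (m = 2 \<and> n = 1)" for m n :: nat
    using two_is_prime_nat prime_product[of m n] by auto
  have w2: "w q = 2 \<longleftrightarrow> (chain_count P q, cover_count P q) \<in> {(2, 3), (3, 2)}" for q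
    unfolding w_def product_2 by auto
  have "gap P = 0 \<longleftrightarrow> S = {}"
    using gap[of 0] sum_eq_0_iff[OF fin, of w] pos
    by (metis of_nat_0 all_not_in_conv not_one_le_zero)
  moreover have "gap P = 1 \<longleftrightarrow> (\<exists>q. S = {q} \<and> w q = 1)"
  proof -
    have nonzero: "w p \<noteq> 0" if "p \<in> S" for p
      using pos[OF that] by simp
    \<comment> \<open>Weights on \<open>S\<close> are positive, so vanishing at all other elements
      means that there are none.\<close>
    have singleton: "(\<forall>p\<in>S. q \<noteq> p \<longrightarrow> w p = 0) \<longleftrightarrow> S = {q}" if "q \<in> S" for q
    proof -
      have "(\<forall>p\<in>S. q \<noteq> p \<longrightarrow> w p = 0) \<longleftrightarrow> (\<forall>p\<in>S. p = q)"
        using nonzero by metis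
      also have "\<dots> \<longleftrightarrow> S = {q}"
        using that by auto
      finally show ?thesis .
    qed
    have "gap P = 1 \<longleftrightarrow> (\<exists>q\<in>S. w q = 1 \<and> (\<forall>p\<in>S. q \<noteq> p \<longrightarrow> w p = 0))"
      using gap[of 1] sum_eq_1_iff[OF fin, of w] by (simp only: of_nat_1)
    also have "\<dots> \<longleftrightarrow> (\<exists>q. S = {q} \<and> w q = 1)"
      using singleton by blast
    finally show ?thesis .
  qed
  moreover have "gap P = 2 \<longleftrightarrow>
      (\<exists>q1 q2. q1 \<noteq> q2 \<and> S = {q1, q2} \<and> w q1 = 1 \<and> w q2 = 1) \<or> (\<exists>q. S = {q} \<and> w q = 2)"
    using gap[of 2] sum_eq_2_iff[OF fin, of w] pos by (simp only: of_nat_numeral)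
  \<comment> \<open>The two cases need different sizes of \<open>S\<close>, so the disjunction is
    the exclusive one demanded by "exactly one".\<close>
  moreover have "\<not> ((\<exists>q1 q2. q1 \<noteq> q2 \<and> S = {q1, q2} \<and> w q1 = 1 \<and> w q2 = 1) \<and> (\<exists>q. S = {q} \<and> w q = 2))"
    by auto
  ultimately show ?thesis
    unfolding S_def[symmetric] w1[symmetric] w2[symmetric] by argo
qed

end
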